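(* Let $\mathbb{K}$ be an algebraically closed field of characteristic zero, let $p\in\mathbb{K}[\mathbf{x},y]$ be a square-free and non-constant polynomial, $e$ an admissible edge of its Newton polytope, and $w$ an element of $C^*(e)$ inducing a total order $\preceq$ on $\mathbb{Q}^n$. Let $N$ be the smallest integer $\geq 1$ such that the series roots of $p$ constructed from $e$ and $w$ can be distinguished by their first $N$ terms, let $\phi$ be one of these series roots, and let $a_1\mathbf{x}^{\alpha_1},\dots,a_N\mathbf{x}^{\alpha_N}$ be its first $N$ terms (that is, the output of the Newton-Puiseux algorithm applied to $p$, $e$, $w$ and $k=0$). Then $\phi$ is the only series solution of $p(\mathbf{x},y)=0$ in $\mathbb{K}_{\preceq}((\mathbf{x}))$ whose first $N$ terms are $a_1\mathbf{x}^{\alpha_1},\dots,a_N\mathbf{x}^{\alpha_N}$.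
   Context: $\mathbf{x}=(x_1,\dots,x_n)$. A series over $\mathbb{K}$ is a formal sum $\phi=\sum_{I\in\mathbb{Q}^n}a_I\mathbf{x}^I$ whose support $\{I:a_I\neq0\}$ is contained in $(v+C)\cap\frac1k\mathbb{Z}^n$ for some $v\in\mathbb{R}^n$, some strictly convex (convex, containing no line) rational (generated by finitely many integer vectors) cone $C\subseteq\mathbb{R}^n$ and some non-zero integer $k$. A vector $w\in\mathbb{R}^n$ with components linearly independent over $\mathbb{Q}$ induces the total order $\alpha\preceq\beta\Leftrightarrow\alpha\cdot w\le\beta\cdot w$ on $\mathbb{Q}^n$; a cone $C$ is compatible with $w$ if $C\cap\mathbb{Q}^n$ has a maximal element with respect to $\preceq$. $\mathbb{K}_{\preceq}((\mathbf{x}))$ is the field of series whose support is contained in $u+C$ for some $u\in\mathbb{Q}^n$ and some compatible strictly convex rational cone $C$. Terms of such a series are ordered decreasingly with respect to $\preceq$; the leading exponent is the maximal exponent. The "first $N$ terms" of a series are its $N$ largest terms; if the series has fewer than $N$ terms, they are all of its terms (and the list is understood to record that the series has ended). $\mathrm{Newt}(p)\subseteq\mathbb{R}^{n+1}$ is the convex hull of $\mathrm{supp}(p)$. An edge $e=\{v_1,v_2\}$ of it is admissible if $v_{1,n+1}\ne v_{2,n+1}$; if $v_{1,n+1}<v_{2,n+1}$ then $\mathrm{m}(e)=v_1$, $\mathrm{M}(e)=v_2$, and its slope is $\mathrm{S}(e)=\frac{1}{v_{2,n+1}-v_{1,n+1}}(v_{2,1}-v_{1,1},\dots,v_{2,n}-v_{1,n})$.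 Let $P_e$ be the projection of $\mathbb{R}^{n+1}$ onto $\mathbb{R}^n\times\{0\}\cong\mathbb{R}^n$ along lines parallel to $e$. The barrier cone $C(e)\subseteq\mathbb{R}^n$ is the smallest (convex) cone containing $P_e(\mathrm{Newt}(p))-P_e(e)$, and its dual is $C^*(e)=C(e)^*=\{w\in\mathbb{R}^n: v\cdot w\le0\text{ for all }v\in C(e)\}$. For square-free $p$, an admissible edge $e$, and $w\in C^*(e)$ inducing a total order $\preceq$, the series roots of $p$ constructed from $e$ and $w$ (by the Newton-Puiseux algorithm) are the roots of $p$ in $\mathbb{K}_{\preceq}((\mathbf{x}))$ whose leading exponent is $-\mathrm{S}(e)$; there are exactly $\mathrm{M}(e)_{n+1}-\mathrm{m}(e)_{n+1}$ of them. On input $(p,e,w,k)$ the algorithm outputs the first $N$ terms of each of them, $N$ being the smallest integer $\ge\max(k,1)$ such that they can be distinguished by their first $N$ terms. *)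

theory Defs
  imports
    "HOL-Analysis.Analysis"
    "HOL-Computational_Algebra.Computational_Algebra"
    "HOL-Library.Poly_Mapping"
begin

text \<open>
  Elements of \<open>K[x\<^sub>1, \<dots>, x\<^sub>n, y]\<close> are univariate polynomials in \<open>y\<close> over the polynomial ring
  \<open>(nat ^ 'n) \<Rightarrow>\<^sub>0 'a\<close> (finitely supported functions from exponent vectors to coefficients, with
  convolution as product). The space \<open>\<real>\<^bsup>n+1\<^esup>\<close> is \<open>(real ^ 'n) \<times> real\<close>, the last coordinate
  belonging to \<open>y\<close>.
\<close>

type_synonym ('a, 'n) xpoly = "(nat ^ 'n) \<Rightarrow>\<^sub>0 'a"

text \<open>A formal sum \<open>\<Sum>\<^sub>I a\<^sub>I x\<^sup>I\<close> with \<open>I \<in> \<rat>\<^sup>n\<close> is its coefficient function.\<close>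

type_synonym ('a, 'n) fsum = "(rat ^ 'n) \<Rightarrow> 'a"

definition rvec :: "rat ^ 'n \<Rightarrow> real ^ 'n" where
  "rvec \<alpha> = (\<chi> i. of_rat (\<alpha> $ i))"

definition supp :: "('a::zero, 'n::finite) fsum \<Rightarrow> (rat ^ 'n) set" where
  "supp \<phi> = {\<alpha>. \<phi> \<alpha> \<noteq> 0}"


subsection \<open>Orders and cones\<close>

definition rat_independent :: "real ^ 'n \<Rightarrow> bool" where
  "rat_independent w \<longleftrightarrow> (\<forall>c :: rat ^ 'n. (\<Sum>i\<in>UNIV. of_rat (c $ i) * w $ i) = 0 \<longrightarrow> c = 0)"

definition preceq :: "real ^ 'n \<Rightarrow> rat ^ 'n \<Rightarrow> rat ^ 'n \<Rightarrow> bool" where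
  "preceq w \<alpha> \<beta> \<longleftrightarrow> rvec \<alpha> \<bullet> w \<le> rvec \<beta> \<bullet> w"

definition rational_cone :: "(real ^ 'n) set \<Rightarrow> bool" where
  "rational_cone C \<longleftrightarrow>
     (\<exists>G :: (int ^ 'n) set. finite G \<and> C = convex_cone hull ((\<lambda>z. \<chi> i. of_int (z $ i)) ` G))"

definition strictly_convex :: "(real ^ 'n) set \<Rightarrow> bool" where
  "strictly_convex C \<longleftrightarrow> convex C \<and> \<not> (\<exists>a d. d \<noteq> 0 \<and> (\<forall>t. a + t *\<^sub>R d \<in> C))"

definition compatible :: "real ^ 'n \<Rightarrow> (real ^ 'n) set \<Rightarrow> bool" where
  "compatible w C \<longleftrightarrow> (\<exists>\<mu>. rvec \<mu> \<in> C \<and> (\<forall>\<alpha>. rvec \<alpha> \<in> C \<longrightarrow> preceq w \<alpha> \<mu>))"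


subsection \<open>Series\<close>

definition is_series :: "('a::zero, 'n::finite) fsum \<Rightarrow> bool" where
  "is_series \<phi> \<longleftrightarrow>
     (\<exists>v C. \<exists>k :: int. strictly_convex C \<and> rational_cone C \<and> k \<noteq> 0 \<and>
        (\<forall>\<alpha>\<in>supp \<phi>. rvec \<alpha> \<in> (\<lambda>c. v + c) ` C \<and>
                     (\<exists>z :: int ^ 'n. \<alpha> = (\<chi> i. of_int (z $ i) / of_int k))))"

definition series_field :: "real ^ 'n \<Rightarrow> ('a::zero, 'n::finite) fsum set" where
  "series_field w =
     {\<phi>. is_series \<phi> \<and>
         (\<exists>u C. strictly_convex C \<and> rational_cone C \<and> compatible w C \<and>
                rvec ` supp \<phi> \<subseteq> (\<lambda>c. rvec u + c) ` C)}"

definition series_one :: "('a::zero_neq_one, 'n::finite) fsum" where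
  "series_one = (\<lambda>\<gamma>. if \<gamma> = 0 then 1 else 0)"

text \<open>
  For two elements of the same \<^const>\<open>series_field\<close> the index set of the sum below is finite;
  for arbitrary formal sums it need not be, and the value is then meaningless.
\<close>

definition series_mult :: "('a::comm_semiring_0, 'n::finite) fsum \<Rightarrow> ('a, 'n::finite) fsum \<Rightarrow> ('a, 'n::finite) fsum" where
  "series_mult \<phi> \<psi> = (\<lambda>\<gamma>. \<Sum>\<beta> | \<beta> \<in> supp \<phi> \<and> \<gamma> - \<beta> \<in> supp \<psi>. \<phi> \<beta> * \<psi> (\<gamma> - \<beta>))"

primrec series_power :: "('a::comm_semiring_1, 'n::finite) fsum \<Rightarrow> nat \<Rightarrow> ('a, 'n::finite) fsum" where
  "series_power \<phi> 0 = series_one"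
| "series_power \<phi> (Suc j) = series_mult \<phi> (series_power \<phi> j)"

definition series_of_xpoly :: "('a::zero, 'n::finite) xpoly \<Rightarrow> ('a, 'n::finite) fsum" where
  "series_of_xpoly c =
     (\<lambda>\<alpha>. if \<exists>I. \<alpha> = (\<chi> i. of_nat (I $ i))
          then Poly_Mapping.lookup c (THE I. \<alpha> = (\<chi> i. of_nat (I $ i))) else 0)"

definition series_eval :: "('a::comm_semiring_1, 'n::finite) xpoly poly \<Rightarrow> ('a, 'n::finite) fsum \<Rightarrow> ('a, 'n::finite) fsum" where
  "series_eval p \<phi> =
     (\<lambda>\<gamma>. \<Sum>j\<le>degree p. series_mult (series_of_xpoly (coeff p j)) (series_power \<phi> j) \<gamma>)"

definition series_solution :: "real ^ 'n \<Rightarrow> ('a::comm_semiring_1, 'n::finite) xpoly poly \<Rightarrow> ('a, 'n::finite) fsum \<Rightarrow> bool" where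
  "series_solution w p \<phi> \<longleftrightarrow> \<phi> \<in> series_field w \<and> series_eval p \<phi> = (\<lambda>_. 0)"

definition leading_exponent :: "real ^ 'n \<Rightarrow> ('a::zero, 'n::finite) fsum \<Rightarrow> rat ^ 'n" where
  "leading_exponent w \<phi> = (THE \<alpha>. \<alpha> \<in> supp \<phi> \<and> (\<forall>\<beta>\<in>supp \<phi>. preceq w \<beta> \<alpha>))"

text \<open>
  The first \<open>N\<close> terms in decreasing order, as pairs of exponent and coefficient. The list is
  shorter than \<open>N\<close> exactly if the series has fewer than \<open>N\<close> terms, so that it records in
  this case that the series has ended.
\<close>

primrec first_terms :: "real ^ 'n \<Rightarrow> nat \<Rightarrow> ('a::zero, 'n::finite) fsum \<Rightarrow> ((rat ^ 'n) \<times> 'a) list" where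
  "first_terms w 0 \<phi> = []"
| "first_terms w (Suc N) \<phi> =
     (if supp \<phi> = {} then []
      else let \<alpha> = leading_exponent w \<phi> in (\<alpha>, \<phi> \<alpha>) # first_terms w N (\<phi>(\<alpha> := 0)))"


subsection \<open>Newton polytopes\<close>

definition poly_supp :: "('a::zero, 'n::finite) xpoly poly \<Rightarrow> ((real ^ 'n) \<times> real) set" where
  "poly_supp p = {((\<chi> i. real (I $ i)), real j) | I j. Poly_Mapping.lookup (coeff p j) I \<noteq> 0}"

definition Newt :: "('a::zero, 'n::finite) xpoly poly \<Rightarrow> ((real ^ 'n) \<times> real) set" where
  "Newt p = convex hull (poly_supp p)"

text \<open>An edge is represented by the set of its two end points.\<close>

definition is_edge :: "((real ^ 'n) \<times> real) set \<Rightarrow> ((real ^ 'n) \<times> real) set \<Rightarrow> bool" where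
  "is_edge e P \<longleftrightarrow> (\<exists>v1 v2. e = {v1, v2} \<and> (closed_segment v1 v2) edge_of P)"

definition admissible_edge :: "((real ^ 'n) \<times> real) set \<Rightarrow> ((real ^ 'n) \<times> real) set \<Rightarrow> bool" where
  "admissible_edge e P \<longleftrightarrow> is_edge e P \<and> (\<exists>v1 v2. e = {v1, v2} \<and> snd v1 \<noteq> snd v2)"

definition minor_vertex :: "((real ^ 'n) \<times> real) set \<Rightarrow> (real ^ 'n) \<times> real" where
  "minor_vertex e = (THE v1. \<exists>v2. e = {v1, v2} \<and> snd v1 < snd v2)"

definition major_vertex :: "((real ^ 'n) \<times> real) set \<Rightarrow> (real ^ 'n) \<times> real" where
  "major_vertex e = (THE v2. \<exists>v1. e = {v1, v2} \<and> snd v1 < snd v2)"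

definition slope :: "((real ^ 'n) \<times> real) set \<Rightarrow> real ^ 'n" where
  "slope e = (1 / (snd (major_vertex e) - snd (minor_vertex e))) *\<^sub>R
               (fst (major_vertex e) - fst (minor_vertex e))"

definition edge_proj :: "((real ^ 'n) \<times> real) set \<Rightarrow> (real ^ 'n) \<times> real \<Rightarrow> real ^ 'n" where
  "edge_proj e z = (THE x. \<exists>t. (x, 0) = z + t *\<^sub>R (major_vertex e - minor_vertex e))"

definition barrier_cone :: "('a::zero, 'n::finite) xpoly poly \<Rightarrow> ((real ^ 'n) \<times> real) set \<Rightarrow> (real ^ 'n) set" where
  "barrier_cone p e =
     convex_cone hull {a - b | a b. a \<in> edge_proj e ` Newt p \<and> b \<in> edge_proj e ` e}"

definition dual_barrier_cone :: "('a::zero, 'n::finite) xpoly poly \<Rightarrow> ((real ^ 'n) \<times> real) set \<Rightarrow> (real ^ 'n) set" where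
  "dual_barrier_cone p e = {w. \<forall>v\<in>barrier_cone p e. v \<bullet> w \<le> 0}"


subsection \<open>Series roots constructed from an edge\<close>

definition series_roots ::
  "('a::comm_semiring_1, 'n::finite) xpoly poly \<Rightarrow> ((real ^ 'n) \<times> real) set \<Rightarrow> real ^ 'n \<Rightarrow> ('a, 'n::finite) fsum set" where
  "series_roots p e w =
     {\<phi>. series_solution w p \<phi> \<and> supp \<phi> \<noteq> {} \<and> rvec (leading_exponent w \<phi>) = - slope e}"

definition distinguished_by_first_terms :: "real ^ 'n \<Rightarrow> nat \<Rightarrow> ('a::zero, 'n::finite) fsum set \<Rightarrow> bool" where
  "distinguished_by_first_terms w N R \<longleftrightarrow> inj_on (first_terms w N) R"

end

theory Submission
  imports Defs
begin

text \<open>The symbol \<open>$\<close> denotes vector components throughout; dropping its use for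
  coefficients of formal power series avoids ambiguous parses.\<close>

no_notation fps_nth (infixl "$" 75)

text \<open>
  The first term of \<open>\<phi>\<close> is recorded because \<open>N \<ge> 1\<close>, so a solution with the same first \<open>N\<close> terms
  is again one of the series roots constructed from \<open>e\<close> and \<open>w\<close>, and these are distinguished by
  their first \<open>N\<close> terms. What has to be shown is that such an \<open>N\<close> exists at all, for otherwise the
  least one would be a junk value. For this, \<open>\<alpha> \<mapsto> \<alpha> \<bullet> w\<close> embeds \<open>\<rat>\<^sup>n\<close> into \<open>\<real>\<close> and turns the
  elements of the series field into series with real exponents of which only finitely many lie above
  any given bound. These series form an integral domain, so \<open>p\<close> has finitely many roots;
  and two different series with this finiteness property differ within finitely many terms.
\<close>


subsection \<open>Series with real exponents\<close>

text \<open>This is the left-finiteness of supports known from the Levi-Civita field, with the order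
  reversed and real exponents. It keeps products finite sums and makes every term reachable from the
  top in finitely many steps.\<close>

definition upper_finite :: "(real \<Rightarrow> 'a::zero) \<Rightarrow> bool" where
  "upper_finite f \<longleftrightarrow> (\<forall>s. finite {t. f t \<noteq> 0 \<and> s \<le> t})"

text \<open>Only pairs of nonzero coefficients are summed, so that the index set is finite for
  \<open>upper_finite\<close> arguments; over an infinite index set the sum takes the default value
  0.\<close>

definition convolution :: "(real \<Rightarrow> 'a::comm_semiring_0) \<Rightarrow> (real \<Rightarrow> 'a) \<Rightarrow> real \<Rightarrow> 'a" where
  "convolution f g t = (\<Sum>s | f s \<noteq> 0 \<and> g (t - s) \<noteq> 0. f s * g (t - s))"

lemma upper_finite_subset:
  "upper_finite f \<Longrightarrow> (\<And>t. t \<in> A \<Longrightarrow> f t \<noteq> 0 \<and> s \<le> t) \<Longrightarrow> finite A"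
  unfolding upper_finite_def by (rule finite_subset[of _ "{t. f t \<noteq> 0 \<and> s \<le> t}"]) auto

lemma upper_finite_bounded:
  assumes "upper_finite f"
  obtains M where "\<And>t. f t \<noteq> 0 \<Longrightarrow> t \<le> M"
proof -
  have "finite {t. f t \<noteq> 0 \<and> 0 \<le> t}"
    using assms by (simp add: upper_finite_def)
  then have "bdd_above {t. f t \<noteq> 0 \<and> 0 \<le> t}"
    by (rule bdd_above_finite)
  then obtain M where "\<forall>t\<in>{t. f t \<noteq> 0 \<and> 0 \<le> t}. t \<le> M"
    unfolding bdd_above_def by blast
  then have "f t \<noteq> 0 \<Longrightarrow> t \<le> max M 0" for t
    by fastforce
  then show thesis by (rule that)
qed

text \<open>Extra indices contribute 0. This allows several convolutions to be written over one
  common finite index set.\<close>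

lemma convolution_superset:
  assumes "finite A" "\<And>s. f s \<noteq> 0 \<Longrightarrow> g (t - s) \<noteq> 0 \<Longrightarrow> s \<in> A"
  shows "convolution f g t = (\<Sum>s\<in>A. f s * g (t - s))"
  unfolding convolution_def using assms by (intro sum.mono_neutral_left) auto

lemma finite_convolution_index:
  assumes "upper_finite f" "upper_finite g"
  shows "finite {s. f s \<noteq> 0 \<and> g (t - s) \<noteq> 0}"
proof -
  obtain M where M: "\<And>s. g s \<noteq> 0 \<Longrightarrow> s \<le> M"
    using upper_finite_bounded[OF assms(2)] by metis
  show ?thesis
    by (rule upper_finite_subset[OF assms(1), of _ "t - M"]) (use M in \<open>force simp: algebra_simps\<close>)
qed

lemma convolution_nonzero_obtain:
  assumes "convolution f g t \<noteq> 0"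
  obtains s where "f s \<noteq> 0" "g (t - s) \<noteq> 0"
proof -
  have "{s. f s \<noteq> 0 \<and> g (t - s) \<noteq> 0} \<noteq> {}"
    using assms unfolding convolution_def by (metis sum.empty)
  then show thesis using that by blast
qed

lemma upper_finite_convolution:
  assumes f: "upper_finite f" and g: "upper_finite g"
  shows "upper_finite (convolution f g)"
  unfolding upper_finite_def
proof
  fix s
  obtain Mf where Mf: "\<And>s. f s \<noteq> 0 \<Longrightarrow> s \<le> Mf"
    using upper_finite_bounded[OF f] by metis
  obtain Mg where Mg: "\<And>s. g s \<noteq> 0 \<Longrightarrow> s \<le> Mg"
    using upper_finite_bounded[OF g] by metis
  \<comment> \<open>If \<open>a + b = t\<close> with \<open>s \<le> t\<close>, then
    \<open>b \<le> Mg\<close> forces \<open>a \<ge> s - Mg\<close>, and symmetrically for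
    \<open>b\<close>. So only finitely many pairs produce an exponent above
    \<open>s\<close>.\<close>
  let ?A = "{t. f t \<noteq> 0 \<and> s - Mg \<le> t}" and ?B = "{t. g t \<noteq> 0 \<and> s - Mf \<le> t}"
  have "t \<in> (\<lambda>(a, b). a + b) ` (?A \<times> ?B)" if t: "convolution f g t \<noteq> 0" "s \<le> t" for t
  proof -
    obtain a where a: "f a \<noteq> 0" "g (t - a) \<noteq> 0"
      using convolution_nonzero_obtain[OF t(1)] by blast
    then have "(a, t - a) \<in> ?A \<times> ?B"
      using Mf[OF a(1)] Mg[OF a(2)] t(2) by auto
    then show ?thesis by force
  qed
  then have "{t. convolution f g t \<noteq> 0 \<and> s \<le> t} \<subseteq> (\<lambda>(a, b). a + b) ` (?A \<times> ?B)"
    by blast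
  moreover have "finite ?A" "finite ?B"
    using f g by (simp_all add: upper_finite_def)
  ultimately show "finite {t. convolution f g t \<noteq> 0 \<and> s \<le> t}"
    by (blast intro: finite_subset)
qed

lemma convolution_commute: "convolution f g = convolution g f"
proof
  fix t
  show "convolution f g t = convolution g f t"
    unfolding convolution_def
    by (rule sum.reindex_bij_witness[of _ "\<lambda>s. t - s" "\<lambda>s. t - s"]) (auto simp: mult.commute)
qed

lemma convolution_add_left:
  assumes f: "upper_finite f" and g: "upper_finite g" and h: "upper_finite h"
  shows "convolution (\<lambda>t. f t + g t) h t = convolution f h t + convolution g h t"
proof -
  \<comment> \<open>The union also covers the support of the sum, which cancellation may make
    smaller.\<close>
  let ?A = "{s. f s \<noteq> 0 \<and> h (t - s) \<noteq> 0} \<union> {s. g s \<noteq> 0 \<and> h (t - s) \<noteq> 0}"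
  have fin: "finite ?A"
    using finite_convolution_index[OF f h] finite_convolution_index[OF g h] by blast
  have "convolution (\<lambda>t. f t + g t) h t = (\<Sum>s\<in>?A. (f s + g s) * h (t - s))"
    by (rule convolution_superset[OF fin]) auto
  moreover have "convolution f h t = (\<Sum>s\<in>?A. f s * h (t - s))"
    by (rule convolution_superset[OF fin]) auto
  moreover have "convolution g h t = (\<Sum>s\<in>?A. g s * h (t - s))"
    by (rule convolution_superset[OF fin]) auto
  ultimately show ?thesis
    by (simp add: sum.distrib distrib_right)
qed

lemma convolution_assoc:
  assumes f: "upper_finite f" and g: "upper_finite g" and h: "upper_finite h"
  shows "convolution (convolution f g) h = convolution f (convolution g h)"
proof
  fix t
  obtain Mf where Mf: "\<And>s. f s \<noteq> 0 \<Longrightarrow> s \<le> Mf"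
    using upper_finite_bounded[OF f] by metis
  obtain Mg where Mg: "\<And>s. g s \<noteq> 0 \<Longrightarrow> s \<le> Mg"
    using upper_finite_bounded[OF g] by metis
  obtain Mh where Mh: "\<And>s. h s \<noteq> 0 \<Longrightarrow> s \<le> Mh"
    using upper_finite_bounded[OF h] by metis
  \<comment> \<open>In a nonzero triple product at \<open>t\<close> with exponents \<open>r\<close>,
    \<open>u\<close> and \<open>t - r - u\<close>, the upper bounds on two of the exponents give a
    lower bound on the third. Hence \<open>r\<close> and \<open>u\<close> range over finite sets,
    and \<open>A\<close> collects the sums \<open>r + u\<close>.\<close>
  define B where "B = {r. f r \<noteq> 0 \<and> t - Mg - Mh \<le> r}"
  define D where "D = {r. g r \<noteq> 0 \<and> t - Mf - Mh \<le> r}"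
  define A where "A = (\<lambda>(a, b). a + b) ` (B \<times> D)"
  have finB: "finite B" and finD: "finite D"
    using f g by (simp_all add: upper_finite_def B_def D_def)
  then have finA: "finite A" by (simp add: A_def)
  have inBD: "r \<in> B \<and> u \<in> D" if "f r \<noteq> 0" "g u \<noteq> 0" "h (t - r - u) \<noteq> 0" for r u
    using Mf[OF that(1)] Mg[OF that(2)] Mh[OF that(3)] that by (auto simp: B_def D_def)
  have "convolution (convolution f g) h t = (\<Sum>s\<in>A. convolution f g s * h (t - s))"
  proof (rule convolution_superset[OF finA])
    fix s assume "convolution f g s \<noteq> 0" and hs: "h (t - s) \<noteq> 0"
    then obtain r where "f r \<noteq> 0" "g (s - r) \<noteq> 0"
      by (auto elim: convolution_nonzero_obtain)
    with inBD[of r "s - r"] hs have "(r, s - r) \<in> B \<times> D" by simp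
    then show "s \<in> A" unfolding A_def by force
  qed
  also have "\<dots> = (\<Sum>s\<in>A. \<Sum>r\<in>B. f r * (g (s - r) * h (t - s)))"
  proof (rule sum.cong[OF refl])
    fix s
    \<comment> \<open>The set \<open>B\<close> is sure to contain all indices of the inner
      convolution only where \<open>h (t - s)\<close> is nonzero; elsewhere both sides
      vanish.\<close>
    show "convolution f g s * h (t - s) = (\<Sum>r\<in>B. f r * (g (s - r) * h (t - s)))"
    proof (cases "h (t - s) = 0")
      case False
      have "convolution f g s = (\<Sum>r\<in>B. f r * g (s - r))"
      proof (rule convolution_superset[OF finB])
        fix r assume "f r \<noteq> 0" "g (s - r) \<noteq> 0"
        with inBD[of r "s - r"] False show "r \<in> B" by simp
      qed
      then show ?thesis by (simp add: sum_distrib_right mult.assoc)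
    qed simp
  qed
  also have "\<dots> = (\<Sum>r\<in>B. f r * (\<Sum>s\<in>A. g (s - r) * h (t - s)))"
    by (subst sum.swap) (simp add: sum_distrib_left)
  also have "\<dots> = (\<Sum>r\<in>B. f r * convolution g h (t - r))"
  proof (rule sum.cong[OF refl])
    fix r assume r: "r \<in> B"
    have "(\<Sum>s\<in>A. g (s - r) * h (t - s)) = (\<Sum>u\<in>(\<lambda>s. s - r) ` A. g u * h (t - r - u))"
      by (subst sum.reindex) (auto simp: inj_on_def)
    also have "\<dots> = convolution g h (t - r)"
    proof (rule convolution_superset[symmetric])
      fix u assume "g u \<noteq> 0" "h (t - r - u) \<noteq> 0"
      with r inBD[of r u] have "(r, u) \<in> B \<times> D" by (simp add: B_def)
      then have "r + u \<in> A" unfolding A_def by force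
      then show "u \<in> (\<lambda>s. s - r) ` A" by force
    qed (simp add: finA)
    finally show "f r * (\<Sum>s\<in>A. g (s - r) * h (t - s)) = f r * convolution g h (t - r)"
      by simp
  qed
  also have "\<dots> = convolution f (convolution g h) t"
  proof (rule convolution_superset[OF finB, symmetric])
    fix r assume fr: "f r \<noteq> 0" and "convolution g h (t - r) \<noteq> 0"
    then obtain u where "g u \<noteq> 0" "h (t - r - u) \<noteq> 0"
      by (auto elim: convolution_nonzero_obtain)
    with inBD fr show "r \<in> B" by blast
  qed
  finally show "convolution (convolution f g) h t = convolution f (convolution g h) t" .
qed

lemma upper_finite_maximal:
  assumes "upper_finite f" "f s \<noteq> 0"
  obtains m where "f m \<noteq> 0" "\<And>t. f t \<noteq> 0 \<Longrightarrow> t \<le> m"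
proof -
  let ?A = "{t. f t \<noteq> 0 \<and> s \<le> t}"
  have fin: "finite ?A" and ne: "?A \<noteq> {}"
    using assms by (auto simp: upper_finite_def)
  have "t \<le> Max ?A" if "f t \<noteq> 0" for t
  proof (cases "s \<le> t")
    case True
    then show ?thesis using fin that by (simp add: Max_ge)
  next
    case False
    then show ?thesis using Max_ge[OF fin, of s] assms by simp
  qed
  moreover have "f (Max ?A) \<noteq> 0" using Max_in[OF fin ne] by blast
  ultimately show thesis using that by blast
qed

text \<open>Leading terms multiply: the sum \<open>m + n\<close> of the two greatest exponents
  arises only from the pair of these exponents, and the product of their coefficients is nonzero in
  a domain.\<close>

lemma convolution_nonzero:
  fixes f g :: "real \<Rightarrow> 'a::idom"
  assumes f: "upper_finite f" "f a \<noteq> 0" and g: "upper_finite g" "g b \<noteq> 0"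
  shows "\<exists>t. convolution f g t \<noteq> 0"
proof -
  obtain m where m: "f m \<noteq> 0" "\<And>t. f t \<noteq> 0 \<Longrightarrow> t \<le> m"
    using upper_finite_maximal[OF f] by metis
  obtain n where n: "g n \<noteq> 0" "\<And>t. g t \<noteq> 0 \<Longrightarrow> t \<le> n"
    using upper_finite_maximal[OF g] by metis
  have "convolution f g (m + n) = (\<Sum>s\<in>{m}. f s * g (m + n - s))"
    by (rule convolution_superset) (use m(2) n(2) in fastforce)+
  then show ?thesis using m(1) n(1) by (intro exI[of _ "m + n"]) simp
qed

section \<open>The integral domain of series with real exponents\<close>

typedef (overloaded) 'a real_exp_series = "{f :: real \<Rightarrow> 'a::zero. upper_finite f}"
  morphisms coefficient Series
  by (rule exI[of _ "\<lambda>_. 0"]) (simp add: upper_finite_def)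

setup_lifting type_definition_real_exp_series

instantiation real_exp_series :: (comm_ring_1) comm_ring_1
begin

lift_definition zero_real_exp_series :: "'a real_exp_series" is "\<lambda>_. 0"
  by (simp add: upper_finite_def)

lift_definition one_real_exp_series :: "'a real_exp_series" is "\<lambda>t. if t = 0 then 1 else 0"
  unfolding upper_finite_def by (auto intro: finite_subset[of _ "{0}"])

lift_definition plus_real_exp_series ::
  "'a real_exp_series \<Rightarrow> 'a real_exp_series \<Rightarrow> 'a real_exp_series" is "\<lambda>f g t. f t + g t"
proof -
  fix f g :: "real \<Rightarrow> 'a" assume fg: "upper_finite f" "upper_finite g"
  show "upper_finite (\<lambda>t. f t + g t)"
    unfolding upper_finite_def
  proof
    fix s
    show "finite {t. f t + g t \<noteq> 0 \<and> s \<le> t}"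
      using fg by (auto simp: upper_finite_def
          intro: finite_subset[of _ "{t. f t \<noteq> 0 \<and> s \<le> t} \<union> {t. g t \<noteq> 0 \<and> s \<le> t}"])
  qed
qed

lift_definition uminus_real_exp_series :: "'a real_exp_series \<Rightarrow> 'a real_exp_series"
  is "\<lambda>f t. - f t"
  by (simp add: upper_finite_def)

definition minus_real_exp_series ::
  "'a real_exp_series \<Rightarrow> 'a real_exp_series \<Rightarrow> 'a real_exp_series" where
  "minus_real_exp_series x y = x + - y"

lift_definition times_real_exp_series ::
  "'a real_exp_series \<Rightarrow> 'a real_exp_series \<Rightarrow> 'a real_exp_series" is convolution
  by (rule upper_finite_convolution)

instance
proof
  fix x y z :: "'a real_exp_series"
  show "x + y + z = x + (y + z)" by transfer (simp add: add.assoc)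
  show "x + y = y + x" by transfer (simp add: add.commute)
  show "0 + x = x" by transfer simp
  show "- x + x = 0" by transfer simp
  show "x - y = x + - y" by (simp add: minus_real_exp_series_def)
  show "x * y * z = x * (y * z)" by transfer (rule convolution_assoc)
  show "x * y = y * x" by transfer (rule convolution_commute)
  show "(x + y) * z = x * z + y * z" by transfer (auto simp: convolution_add_left)
  show "1 * x = x"
  proof transfer
    fix f :: "real \<Rightarrow> 'a"
    show "convolution (\<lambda>t. if t = 0 then 1 else 0) f = f"
      by (rule ext, subst convolution_superset[of "{0}"]) (auto split: if_splits)
  qed
  show "(0 :: 'a real_exp_series) \<noteq> 1" by transfer (metis zero_neq_one)
qed

end

text \<open>Without zero divisors, a nonzero polynomial over these series has only finitely many
  roots.\<close>

instance real_exp_series :: (idom) idom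
proof
  fix x y :: "'a real_exp_series"
  assume "x \<noteq> 0" "y \<noteq> 0"
  then show "x * y \<noteq> 0"
    by transfer (metis convolution_nonzero)
qed

lemma coefficient_sum: "coefficient (\<Sum>i\<in>A. x i) t = (\<Sum>i\<in>A. coefficient (x i) t)"
  by (induction A rule: infinite_finite_induct)
    (auto simp: zero_real_exp_series.rep_eq plus_real_exp_series.rep_eq)


subsection \<open>The embedding of the series field\<close>

definition weight :: "real ^ 'n \<Rightarrow> rat ^ 'n \<Rightarrow> real" where
  "weight w \<alpha> = rvec \<alpha> \<bullet> w"

lemma weight_altdef: "weight w \<alpha> = (\<Sum>i\<in>UNIV. of_rat (\<alpha> $ i) * w $ i)"
  by (simp add: weight_def inner_vec_def rvec_def)

lemma preceq_iff_weight: "preceq w \<alpha> \<beta> \<longleftrightarrow> weight w \<alpha> \<le> weight w \<beta>"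
  by (simp add: preceq_def weight_def)

lemma rvec_add: "rvec (\<alpha> + \<beta>) = rvec \<alpha> + rvec \<beta>"
  by (simp add: rvec_def vec_eq_iff of_rat_add)

lemma rvec_diff: "rvec (\<alpha> - \<beta>) = rvec \<alpha> - rvec \<beta>"
  by (simp add: rvec_def vec_eq_iff of_rat_diff)

lemma weight_add: "weight w (\<alpha> + \<beta>) = weight w \<alpha> + weight w \<beta>"
  by (simp add: weight_def rvec_add inner_add_left)

lemma weight_diff: "weight w (\<alpha> - \<beta>) = weight w \<alpha> - weight w \<beta>"
  by (simp add: weight_def rvec_diff inner_diff_left)

lemma weight_zero: "weight w 0 = 0"
  by (simp add: weight_altdef)

text \<open>Independence over the rationals says precisely that the additive map
  \<open>weight w\<close> has trivial kernel.\<close>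

lemma inj_weight:
  assumes "rat_independent w"
  shows "inj (weight w)"
proof (rule injI)
  fix \<alpha> \<beta> assume "weight w \<alpha> = weight w \<beta>"
  then have "weight w (\<alpha> - \<beta>) = 0" by (simp add: weight_diff)
  with assms have "\<alpha> - \<beta> = 0" unfolding rat_independent_def weight_altdef by blast
  then show "\<alpha> = \<beta>" by simp
qed

definition weight_finite :: "real ^ 'n \<Rightarrow> ('a::zero, 'n::finite) fsum \<Rightarrow> bool" where
  "weight_finite w \<phi> \<longleftrightarrow> (\<forall>s. finite {\<alpha>\<in>supp \<phi>. s \<le> weight w \<alpha>})"

text \<open>The coefficients are transported along \<open>weight w\<close> and extended by 0 off its
  range. The use of \<open>inv\<close> is a genuine inversion once \<open>w\<close> is
  \<open>rat_independent\<close>.\<close>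

definition push :: "real ^ 'n \<Rightarrow> ('a::zero, 'n::finite) fsum \<Rightarrow> real \<Rightarrow> 'a" where
  "push w \<phi> t = (if t \<in> range (weight w) then \<phi> (inv (weight w) t) else 0)"

lemma push_weight: "rat_independent w \<Longrightarrow> push w \<phi> (weight w \<alpha>) = \<phi> \<alpha>"
  by (simp add: push_def inv_f_f inj_weight)

lemma push_nonzero_obtain:
  assumes "rat_independent w" "push w \<phi> t \<noteq> 0"
  obtains \<alpha> where "t = weight w \<alpha>" "\<alpha> \<in> supp \<phi>"
proof -
  have "t \<in> range (weight w)" using assms(2) by (auto simp: push_def split: if_splits)
  then obtain \<alpha> where "t = weight w \<alpha>" by blast
  then show thesis using assms by (intro that) (auto simp: push_weight supp_def)
qed

lemma push_inject:
  assumes "rat_independent w" "push w \<phi> = push w \<psi>"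
  shows "\<phi> = \<psi>"
  using assms by (metis push_weight ext)

lemma upper_finite_push:
  assumes w: "rat_independent w" and "weight_finite w \<phi>"
  shows "upper_finite (push w \<phi>)"
  unfolding upper_finite_def
proof
  fix s
  have "{t. push w \<phi> t \<noteq> 0 \<and> s \<le> t} \<subseteq> weight w ` {\<alpha>\<in>supp \<phi>. s \<le> weight w \<alpha>}"
    using w by (auto elim!: push_nonzero_obtain)
  then show "finite {t. push w \<phi> t \<noteq> 0 \<and> s \<le> t}"
    using assms(2) by (auto simp: weight_finite_def intro: finite_subset)
qed

lemma push_one:
  assumes w: "rat_independent w"
  shows "push w series_one = (\<lambda>t. if t = 0 then 1 else 0)"
proof
  fix t
  show "push w series_one t = (if t = 0 then 1 else 0)"
  proof (cases "t \<in> range (weight w)")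
    case True
    then obtain \<alpha> where t: "t = weight w \<alpha>" by blast
    have "weight w \<alpha> = 0 \<longleftrightarrow> \<alpha> = 0"
      using inj_weight[OF w] weight_zero[of w] by (metis injD)
    then show ?thesis by (simp add: t push_weight[OF w] series_one_def)
  next
    case False
    then have "t \<noteq> 0" using weight_zero[of w] by (metis rangeI)
    with False show ?thesis by (simp add: push_def)
  qed
qed

text \<open>On the range of \<open>weight w\<close> the two index sets correspond bijectively, so
  the sums agree, both being 0 if the sets are infinite. Off the range the convolution vanishes
  because the range is closed under addition.\<close>

lemma push_mult:
  assumes w: "rat_independent w"
  shows "push w (series_mult \<phi> \<psi>) = convolution (push w \<phi>) (push w \<psi>)"
proof
  fix t
  show "push w (series_mult \<phi> \<psi>) t = convolution (push w \<phi>) (push w \<psi>) t"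
  proof (cases "t \<in> range (weight w)")
    case True
    then obtain \<gamma> where t: "t = weight w \<gamma>" by blast
    let ?A = "{\<beta>. \<beta> \<in> supp \<phi> \<and> \<gamma> - \<beta> \<in> supp \<psi>}"
    have "{s. push w \<phi> s \<noteq> 0 \<and> push w \<psi> (t - s) \<noteq> 0} = weight w ` ?A"
    proof (intro equalityI subsetI)
      fix s assume "s \<in> {s. push w \<phi> s \<noteq> 0 \<and> push w \<psi> (t - s) \<noteq> 0}"
      then have s: "push w \<phi> s \<noteq> 0" "push w \<psi> (t - s) \<noteq> 0" by auto
      obtain \<beta> where \<beta>: "s = weight w \<beta>" "\<beta> \<in> supp \<phi>"
        using w s(1) by (rule push_nonzero_obtain)
      have "\<gamma> - \<beta> \<in> supp \<psi>"
        using s(2) by (simp add: t \<beta>(1) weight_diff[symmetric] push_weight[OF w] supp_def)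
      with \<beta> show "s \<in> weight w ` ?A" by blast
    qed (auto simp: t weight_diff[symmetric] push_weight[OF w] supp_def)
    moreover have "inj_on (weight w) ?A"
      using inj_weight[OF w] by (rule inj_on_subset) simp
    ultimately show ?thesis
      by (simp add: convolution_def t push_weight[OF w] series_mult_def sum.reindex
          weight_diff[symmetric])
  next
    case False
    have "convolution (push w \<phi>) (push w \<psi>) t = 0"
    proof (rule ccontr)
      assume "convolution (push w \<phi>) (push w \<psi>) t \<noteq> 0"
      then obtain s where s: "push w \<phi> s \<noteq> 0" "push w \<psi> (t - s) \<noteq> 0"
        using convolution_nonzero_obtain by blast
      obtain \<alpha> where "s = weight w \<alpha>" using w s(1) by (rule push_nonzero_obtain)
      moreover obtain \<beta> where "t - s = weight w \<beta>" using w s(2) by (rule push_nonzero_obtain)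
      ultimately have "t = weight w (\<alpha> + \<beta>)" by (simp add: weight_add)
      with False show False by blast
    qed
    with False show ?thesis by (simp add: push_def)
  qed
qed

section \<open>Polynomial coefficients and roots under the embedding\<close>

lemma series_of_xpoly_nat:
  fixes c :: "('a::zero, 'n::finite) xpoly" and I :: "nat ^ 'n"
  shows "series_of_xpoly c (\<chi> i. of_nat (I $ i)) = Poly_Mapping.lookup c I"
proof -
  \<comment> \<open>Natural exponent vectors embed injectively into rational ones, so the
    description is satisfied by \<open>I\<close> alone.\<close>
  have "(THE J :: nat ^ 'n. (\<chi> i. of_nat (I $ i) ) = ((\<chi> i. of_nat (J $ i)) :: rat ^ 'n)) = I"
    by (rule the_equality) (auto simp: vec_eq_iff)
  then show ?thesis unfolding series_of_xpoly_def by auto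
qed

lemma supp_series_of_xpoly_finite: "finite (supp (series_of_xpoly c))"
proof -
  have "supp (series_of_xpoly c) \<subseteq> (\<lambda>I. \<chi> i. of_nat (I $ i)) ` Poly_Mapping.keys c"
  proof
    fix \<alpha> assume \<alpha>: "\<alpha> \<in> supp (series_of_xpoly c)"
    then obtain I where "\<alpha> = (\<chi> i. of_nat (I $ i))"
      by (auto simp: supp_def series_of_xpoly_def split: if_splits)
    moreover from this \<alpha> have "I \<in> Poly_Mapping.keys c"
      by (simp add: supp_def series_of_xpoly_nat in_keys_iff)
    ultimately show "\<alpha> \<in> (\<lambda>I. \<chi> i. of_nat (I $ i)) ` Poly_Mapping.keys c" by blast
  qed
  then show ?thesis by (rule finite_subset) simp
qed

text \<open>The value is meaningful only if \<open>push w \<phi>\<close> is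
  \<open>upper_finite\<close>, as it is for \<open>rat_independent\<close> \<open>w\<close> and
  \<open>weight_finite\<close> \<open>\<phi>\<close>.\<close>

definition embed :: "real ^ 'n \<Rightarrow> ('a::zero, 'n::finite) fsum \<Rightarrow> 'a real_exp_series" where
  "embed w \<phi> = Series (push w \<phi>)"

lemma coefficient_embed:
  "rat_independent w \<Longrightarrow> weight_finite w \<phi> \<Longrightarrow> coefficient (embed w \<phi>) = push w \<phi>"
  by (simp add: embed_def Series_inverse upper_finite_push)

lemma coefficient_embed_xpoly:
  "rat_independent w \<Longrightarrow> coefficient (embed w (series_of_xpoly c)) = push w (series_of_xpoly c)"
  by (rule coefficient_embed)
    (auto simp: weight_finite_def intro: finite_subset[OF _ supp_series_of_xpoly_finite])

text \<open>Serves to show that mapping the coefficients of \<open>p\<close> into the domain of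
  series preserves its degree and keeps a nonzero \<open>p\<close> nonzero.\<close>

lemma embed_xpoly_eq_0_iff:
  fixes c :: "('a::comm_ring_1, 'n::finite) xpoly"
  assumes w: "rat_independent w"
  shows "embed w (series_of_xpoly c) = 0 \<longleftrightarrow> c = 0"
proof
  assume "embed w (series_of_xpoly c) = 0"
  then have "push w (series_of_xpoly c) = (\<lambda>_. 0)"
    by (metis coefficient_embed_xpoly[OF w] zero_real_exp_series.rep_eq)
  then have "series_of_xpoly c \<alpha> = 0" for \<alpha>
    using push_weight[OF w, of "series_of_xpoly c" \<alpha>] by simp
  then have "Poly_Mapping.lookup c I = 0" for I
    by (metis series_of_xpoly_nat)
  then show "c = 0" by (intro poly_mapping_eqI) simp
next
  assume "c = 0"
  then have "push w (series_of_xpoly c) = (\<lambda>_. 0)"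
    by (auto simp: push_def series_of_xpoly_def)
  then have "coefficient (embed w (series_of_xpoly c)) = coefficient 0"
    by (simp only: coefficient_embed_xpoly[OF w] zero_real_exp_series.rep_eq)
  then show "embed w (series_of_xpoly c) = 0" by (simp add: coefficient_inject)
qed

text \<open>Powers are formed inside the type of series, which is closed under multiplication, and
  are compared with \<open>series_power\<close> through \<open>push_mult\<close>.\<close>

lemma coefficient_embed_power:
  fixes \<phi> :: "('a::comm_ring_1, 'n::finite) fsum"
  assumes w: "rat_independent w" and "weight_finite w \<phi>"
  shows "coefficient (embed w \<phi> ^ j) = push w (series_power \<phi> j)"
  by (induction j)
    (simp_all add: one_real_exp_series.rep_eq times_real_exp_series.rep_eq push_one[OF w]
      push_mult[OF w] coefficient_embed[OF assms])

lemma embed_root: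
  fixes p :: "('a::comm_ring_1, 'n::finite) xpoly poly"
  assumes w: "rat_independent w" and \<phi>: "weight_finite w \<phi>"
    and root: "series_eval p \<phi> = (\<lambda>_. 0)"
  shows "poly (map_poly (\<lambda>c. embed w (series_of_xpoly c)) p) (embed w \<phi>) = 0"
proof -
  let ?f = "\<lambda>c. embed w (series_of_xpoly c)"
  have f0: "?f 0 = 0" using w by (simp add: embed_xpoly_eq_0_iff)
  have "poly (map_poly ?f p) (embed w \<phi>) = (\<Sum>j\<le>degree p. ?f (coeff p j) * embed w \<phi> ^ j)"
    using w by (simp add: poly_altdef degree_map_poly embed_xpoly_eq_0_iff coeff_map_poly f0)
  moreover have "coefficient (\<Sum>j\<le>degree p. ?f (coeff p j) * embed w \<phi> ^ j) t = 0" for t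
  proof -
    have "coefficient (\<Sum>j\<le>degree p. ?f (coeff p j) * embed w \<phi> ^ j) t =
      (\<Sum>j\<le>degree p. push w (series_mult (series_of_xpoly (coeff p j)) (series_power \<phi> j)) t)"
      by (simp add: coefficient_sum times_real_exp_series.rep_eq coefficient_embed_xpoly[OF w]
          coefficient_embed_power[OF w \<phi>] push_mult[OF w])
    also have "\<dots> = push w (series_eval p \<phi>) t"
      by (simp add: push_def series_eval_def)
    also have "\<dots> = 0"
      by (simp add: root push_def)
    finally show ?thesis .
  qed
  ultimately have "coefficient (poly (map_poly ?f p) (embed w \<phi>)) = coefficient 0"
    by (simp add: fun_eq_iff zero_real_exp_series.rep_eq)
  then show ?thesis by (simp only: coefficient_inject)
qed

text \<open>The embedding is injective on \<open>weight_finite\<close> sums and sends roots of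
  \<open>p\<close> to roots of a nonzero polynomial over an integral domain.\<close>

lemma finite_weight_finite_roots:
  fixes p :: "('a::idom, 'n::finite) xpoly poly"
  assumes w: "rat_independent w" and "p \<noteq> 0"
  shows "finite {\<phi>. weight_finite w \<phi> \<and> series_eval p \<phi> = (\<lambda>_. 0)}" (is "finite ?R")
proof -
  let ?q = "map_poly (\<lambda>c. embed w (series_of_xpoly c)) p"
  have "?q \<noteq> 0"
    using w \<open>p \<noteq> 0\<close> by (subst map_poly_eq_0_iff) (auto simp: embed_xpoly_eq_0_iff)
  then have "finite {x. poly ?q x = 0}" by (rule poly_roots_finite)
  moreover have "embed w ` ?R \<subseteq> {x. poly ?q x = 0}"
    using embed_root[OF w] by blast
  moreover have "inj_on (embed w) ?R"
  proof (rule inj_onI)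
    fix \<phi> \<psi> assume "\<phi> \<in> ?R" "\<psi> \<in> ?R" "embed w \<phi> = embed w \<psi>"
    then have "push w \<phi> = push w \<psi>"
      using coefficient_embed[OF w] by (metis (mono_tags, lifting) mem_Collect_eq)
    then show "\<phi> = \<psi>" by (rule push_inject[OF w])
  qed
  ultimately show ?thesis by (meson finite_imageD finite_subset)
qed


subsection \<open>Supports in compatible cones\<close>

text \<open>Every nonzero generator of the cone has strictly negative product with \<open>w\<close>.
  Hence the linear form \<open>- (c \<bullet> w)\<close> dominates the norm on the finitely many
  generators, and then on the cone they span.\<close>

lemma compatible_cone_norm_bound:
  fixes w :: "real ^ 'n::finite"
  assumes w: "rat_independent w" and "rational_cone C" "compatible w C"
  obtains K where "K \<ge> 0" "\<And>c. c \<in> C \<Longrightarrow> norm c \<le> K * - (c \<bullet> w)"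
proof -
  obtain G :: "(int ^ 'n) set" where G: "finite G"
      and C: "C = convex_cone hull ((\<lambda>z. \<chi> i. of_int (z $ i)) ` G)"
    using assms(2) unfolding rational_cone_def by blast
  obtain \<mu> where \<mu>: "rvec \<mu> \<in> C" "\<And>\<alpha>. rvec \<alpha> \<in> C \<Longrightarrow> weight w \<alpha> \<le> weight w \<mu>"
    using assms(3) unfolding compatible_def preceq_iff_weight by blast
  let ?r = "\<lambda>z :: int ^ 'n. (\<chi> i. of_int (z $ i)) :: real ^ 'n"
  let ?q = "\<lambda>z :: int ^ 'n. (\<chi> i. of_int (z $ i)) :: rat ^ 'n"
  have r_eq: "?r z = rvec (?q z)" for z
    by (simp add: rvec_def vec_eq_iff)
  \<comment> \<open>Adding a generator to the maximal element \<mu> stays in the cone, so its weight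
    is at most 0. Weight 0 is excluded for a nonzero generator, since its components are
    rational.\<close>
  have neg: "?r z \<bullet> w < 0" if "z \<in> G" "?r z \<noteq> 0" for z
  proof -
    have "?r z \<in> C" using that(1) unfolding C by (simp add: hull_inc)
    then have "rvec (?q z + \<mu>) \<in> C"
      using \<mu>(1) unfolding rvec_add r_eq C by (rule convex_cone_hull_add)
    then have "weight w (?q z) \<le> 0" using \<mu>(2) by (fastforce simp: weight_add)
    moreover have "weight w (?q z) \<noteq> 0"
    proof
      assume "weight w (?q z) = 0"
      then have "?q z = 0" using w unfolding rat_independent_def weight_altdef by blast
      with that(2) show False by (simp add: vec_eq_iff)
    qed
    ultimately show ?thesis by (simp add: weight_def r_eq)
  qed
  \<comment> \<open>The largest ratio over all generators; the inserted 0 handles an empty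
    \<open>G\<close> and makes \<open>K\<close> nonnegative.\<close>
  define K where "K = Max (insert 0 ((\<lambda>z. norm (?r z) / - (?r z \<bullet> w)) ` G))"
  have K: "norm (?r z) \<le> K * - (?r z \<bullet> w)" if "z \<in> G" for z
  proof (cases "?r z = 0")
    case False
    have "norm (?r z) / - (?r z \<bullet> w) \<le> K"
      unfolding K_def using G that by (intro Max_ge) auto
    then show ?thesis using neg[OF that False] by (simp add: field_simps)
  qed simp
  \<comment> \<open>The inequality survives sums and nonnegative multiples, so it passes from the
    generators to their hull.\<close>
  have "convex_cone {c. norm c \<le> K * - (c \<bullet> w)}"
    unfolding convex_cone_iff
  proof (safe, goal_cases)
    case (2 x y)
    then show ?case using norm_triangle_ineq[of x y] by (simp add: inner_add_left algebra_simps)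
  next
    case (3 x c)
    then have "c * norm x \<le> c * (K * - (x \<bullet> w))" by (intro mult_left_mono) auto
    with 3 show ?case by (simp add: algebra_simps)
  qed auto
  then have "C \<subseteq> {c. norm c \<le> K * - (c \<bullet> w)}"
    unfolding C using K by (intro hull_minimal) auto
  moreover have "K \<ge> 0"
    unfolding K_def using G by (intro Max_ge) auto
  ultimately show thesis by (intro that[of K]) auto
qed

lemma finite_bounded_int_vec: "finite {z :: int ^ 'n::finite. \<forall>i. \<bar>z $ i\<bar> \<le> B}"
proof -
  have "finite ((UNIV :: 'n set) \<rightarrow>\<^sub>E {-B..B})" by (intro finite_PiE) auto
  then have "finite ((\<lambda>f. vec_lambda f) ` ((UNIV :: 'n set) \<rightarrow>\<^sub>E {-B..B}))" by (rule finite_imageI)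
  moreover have "z \<in> (\<lambda>f. vec_lambda f) ` (UNIV \<rightarrow>\<^sub>E {-B..B})" if "\<forall>i. \<bar>z $ i\<bar> \<le> B" for z :: "int ^ 'n"
    using that by (intro image_eqI[of _ _ "vec_nth z"]) (auto simp: abs_le_iff minus_le_iff)
  ultimately show ?thesis by (auto intro: finite_subset)
qed

text \<open>A lower bound on the weight bounds the norm of the exponent, by the estimate on
  compatible cones. The exponents also lie in the lattice of vectors with common denominator
  \<open>k\<close>, which has only finitely many points in a bounded region.\<close>

lemma weight_finite_series_field:
  fixes \<phi> :: "('a::zero, 'n::finite) fsum"
  assumes w: "rat_independent w" and \<phi>: "\<phi> \<in> series_field w"
  shows "weight_finite w \<phi>"
  unfolding weight_finite_def
proof
  fix s
  obtain k :: int where k: "k \<noteq> 0"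
    and z: "\<And>\<alpha>. \<alpha> \<in> supp \<phi> \<Longrightarrow> \<exists>z :: int ^ 'n. \<alpha> = (\<chi> i. of_int (z $ i) / of_int k)"
    using \<phi> unfolding series_field_def is_series_def by blast
  obtain u C where "rational_cone C" "compatible w C"
    and sub: "rvec ` supp \<phi> \<subseteq> (\<lambda>c. rvec u + c) ` C"
    using \<phi> unfolding series_field_def by blast
  then obtain K where K: "\<And>c. c \<in> C \<Longrightarrow> norm c \<le> K * - (c \<bullet> w)" and "K \<ge> 0"
    using compatible_cone_norm_bound[OF w] by metis
  \<comment> \<open>Here \<open>R\<close> bounds the norm of an exponent of weight at least
    \<open>s\<close>, and \<open>B\<close> the integer numerators over the denominator
    \<open>k\<close>.\<close>
  define R where "R = norm (rvec u) + K * \<bar>weight w u - s\<bar>"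
  define B where "B = \<lceil>\<bar>real_of_int k\<bar> * R\<rceil>"
  let ?v = "\<lambda>z :: int ^ 'n. (\<chi> i. of_int (z $ i) / of_int k) :: rat ^ 'n"
  have "\<alpha> \<in> ?v ` {z. \<forall>i. \<bar>z $ i\<bar> \<le> B}" if \<alpha>: "\<alpha> \<in> supp \<phi>" "s \<le> weight w \<alpha>" for \<alpha>
  proof -
    obtain z where z: "\<alpha> = ?v z" using z[OF \<alpha>(1)] by blast
    obtain c where c: "c \<in> C" "rvec \<alpha> = rvec u + c" using sub \<alpha>(1) by blast
    have cw: "- (c \<bullet> w) \<le> \<bar>weight w u - s\<bar>"
      using \<alpha>(2) by (simp add: weight_def c(2) inner_add_left)
    have "norm c \<le> K * - (c \<bullet> w)" by (rule K[OF c(1)])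
    also have "\<dots> \<le> K * \<bar>weight w u - s\<bar>" using cw \<open>K \<ge> 0\<close> by (rule mult_left_mono)
    finally have "norm (rvec \<alpha>) \<le> R"
      unfolding R_def c(2) using norm_triangle_ineq[of "rvec u" c] by linarith
    have "\<bar>z $ i\<bar> \<le> B" for i
    proof -
      have "real_of_int (z $ i) = of_int k * (rvec \<alpha> $ i)"
        using k by (simp add: z rvec_def of_rat_divide)
      then have "\<bar>real_of_int (z $ i)\<bar> = \<bar>of_int k\<bar> * \<bar>rvec \<alpha> $ i\<bar>"
        by (simp add: abs_mult)
      also have "\<dots> \<le> \<bar>of_int k\<bar> * R"
        using component_le_norm_cart[of "rvec \<alpha>" i] \<open>norm (rvec \<alpha>) \<le> R\<close>
        by (intro mult_left_mono) auto
      finally show ?thesis unfolding B_def by linarith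
    qed
    then show ?thesis using z by blast
  qed
  then have "{\<alpha>\<in>supp \<phi>. s \<le> weight w \<alpha>} \<subseteq> ?v ` {z. \<forall>i. \<bar>z $ i\<bar> \<le> B}" by blast
  then show "finite {\<alpha>\<in>supp \<phi>. s \<le> weight w \<alpha>}"
    by (rule finite_subset) (simp add: finite_bounded_int_vec)
qed


subsection \<open>First terms\<close>

lemma weight_finite_update: "weight_finite w \<phi> \<Longrightarrow> weight_finite w (\<phi>(\<alpha> := 0))"
  unfolding weight_finite_def
  by (auto simp: supp_def intro: finite_subset[rotated] split: if_splits)

text \<open>The description is well defined: a maximum exists because only finitely many terms lie
  above a given one, and it is unique because \<open>weight w\<close> is injective.\<close>

lemma leading_exponent_greatest:
  assumes w: "rat_independent w" and "weight_finite w \<phi>" "supp \<phi> \<noteq> {}"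
  shows "leading_exponent w \<phi> \<in> supp \<phi>"
    and "\<beta> \<in> supp \<phi> \<Longrightarrow> weight w \<beta> \<le> weight w (leading_exponent w \<phi>)"
proof -
  obtain \<alpha>' where \<alpha>': "\<alpha>' \<in> supp \<phi>" using assms(3) by blast
  have "upper_finite (push w \<phi>)" using assms by (intro upper_finite_push)
  moreover have "push w \<phi> (weight w \<alpha>') \<noteq> 0"
    using \<alpha>' by (simp add: push_weight[OF w] supp_def)
  ultimately obtain m where m: "push w \<phi> m \<noteq> 0" "\<And>t. push w \<phi> t \<noteq> 0 \<Longrightarrow> t \<le> m"
    by (rule upper_finite_maximal) blast
  obtain \<alpha> where \<alpha>: "m = weight w \<alpha>" "\<alpha> \<in> supp \<phi>"
    using w m(1) by (rule push_nonzero_obtain)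
  have max: "\<forall>\<beta>\<in>supp \<phi>. weight w \<beta> \<le> weight w \<alpha>"
    using m(2) by (auto simp: \<alpha>(1) supp_def push_weight[OF w])
  have "leading_exponent w \<phi> = \<alpha>"
    unfolding leading_exponent_def preceq_iff_weight
  proof (rule the_equality)
    fix \<beta> assume "\<beta> \<in> supp \<phi> \<and> (\<forall>\<gamma>\<in>supp \<phi>. weight w \<gamma> \<le> weight w \<beta>)"
    then have "weight w \<beta> = weight w \<alpha>" using max \<alpha>(2) by (intro order_antisym) auto
    then show "\<beta> = \<alpha>" by (rule injD[OF inj_weight[OF w]])
  qed (use \<alpha>(2) max in blast)
  with \<alpha>(2) max show "leading_exponent w \<phi> \<in> supp \<phi>"
    "\<beta> \<in> supp \<phi> \<Longrightarrow> weight w \<beta> \<le> weight w (leading_exponent w \<phi>)" by auto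
qed

lemma card_terms_above_update:
  assumes w: "rat_independent w" and \<phi>: "weight_finite w \<phi>" "supp \<phi> \<noteq> {}"
    and card: "card {\<alpha>\<in>supp \<phi>. weight w \<gamma> \<le> weight w \<alpha>} \<le> Suc N"
  shows "card {\<alpha>\<in>supp (\<phi>(leading_exponent w \<phi> := 0)). weight w \<gamma> \<le> weight w \<alpha>} \<le> N"
proof -
  let ?l = "leading_exponent w \<phi>" and ?A = "{\<alpha>\<in>supp \<phi>. weight w \<gamma> \<le> weight w \<alpha>}"
  have eq: "{\<alpha>\<in>supp (\<phi>(?l := 0)). weight w \<gamma> \<le> weight w \<alpha>} = ?A - {?l}"
    by (auto simp: supp_def)
  have fin: "finite ?A" using \<phi>(1) by (simp add: weight_finite_def)
  show ?thesis
  proof (cases "?l \<in> ?A")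
    case True
    then show ?thesis using card fin by (simp add: eq card_Diff_singleton)
  next
    case False
    \<comment> \<open>If even the greatest exponent lies below \<gamma>, no term is counted at
      all.\<close>
    with leading_exponent_greatest[OF w \<phi>] have "?A - {?l} = {}" by fastforce
    then show ?thesis unfolding eq by (metis card.empty le0)
  qed
qed

text \<open>If at most \<open>N\<close> terms lie at or above \<gamma>, the first \<open>N\<close>
  terms reach down to \<gamma> and settle the coefficient there, including the case that it is 0.
  The induction strips the common leading term from both series.\<close>

lemma first_terms_determine:
  assumes w: "rat_independent w"
  shows "weight_finite w \<phi> \<Longrightarrow> weight_finite w \<psi> \<Longrightarrow>
    first_terms w N \<phi> = first_terms w N \<psi> \<Longrightarrow>
    card {\<alpha>\<in>supp \<phi>. weight w \<gamma> \<le> weight w \<alpha>} \<le> N \<Longrightarrow>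
    card {\<alpha>\<in>supp \<psi>. weight w \<gamma> \<le> weight w \<alpha>} \<le> N \<Longrightarrow> \<phi> \<gamma> = \<psi> \<gamma>"
proof (induction N arbitrary: \<phi> \<psi>)
  case 0
  \<comment> \<open>Cardinality 0 means emptiness here because the set is finite; hence \<gamma> is
    not in the support.\<close>
  have "\<theta> \<gamma> = 0" if "weight_finite w \<theta>" "card {\<alpha>\<in>supp \<theta>. weight w \<gamma> \<le> weight w \<alpha>} \<le> 0"
    for \<theta> :: "('b, 'a) fsum"
    using that by (auto simp: weight_finite_def supp_def)
  with 0 show ?case by metis
next
  case (Suc N)
  show ?case
  proof (cases "supp \<phi> = {} \<or> supp \<psi> = {}")
    case True
    then have "supp \<phi> = {}" "supp \<psi> = {}"
      using Suc.prems(3) by (auto simp: Let_def split: if_splits)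
    then show ?thesis by (simp add: supp_def)
  next
    case False
    let ?l = "leading_exponent w \<phi>"
    have eqs: "leading_exponent w \<psi> = ?l" "\<psi> ?l = \<phi> ?l"
      "first_terms w N (\<phi>(?l := 0)) = first_terms w N (\<psi>(?l := 0))"
      using Suc.prems(3) False by (auto simp: Let_def)
    show ?thesis
    proof (cases "\<gamma> = ?l")
      case True
      then show ?thesis using eqs(2) by simp
    next
      case ne: False
      have "(\<phi>(?l := 0)) \<gamma> = (\<psi>(?l := 0)) \<gamma>"
      proof (rule Suc.IH)
        show "card {\<alpha>\<in>supp (\<phi>(?l := 0)). weight w \<gamma> \<le> weight w \<alpha>} \<le> N"
          using Suc.prems False by (intro card_terms_above_update[OF w]) auto
        show "card {\<alpha>\<in>supp (\<psi>(?l := 0)). weight w \<gamma> \<le> weight w \<alpha>} \<le> N"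
          using card_terms_above_update[OF w, of \<psi> \<gamma> N] Suc.prems False by (simp add: eqs(1))
      qed (use Suc.prems eqs(3) weight_finite_update in blast)+
      with ne show ?thesis by simp
    qed
  qed
qed

section \<open>Telling finitely many series apart\<close>

lemma eventually_first_terms_differ:
  assumes w: "rat_independent w" and "weight_finite w \<phi>" "weight_finite w \<psi>" "\<phi> \<noteq> \<psi>"
  shows "eventually (\<lambda>N. first_terms w N \<phi> \<noteq> first_terms w N \<psi>) sequentially"
proof -
  \<comment> \<open>Any \<open>N\<close> not below the numbers of terms of the two series at or
    above \<gamma> will do.\<close>
  obtain \<gamma> where "\<phi> \<gamma> \<noteq> \<psi> \<gamma>" using assms(4) by blast
  then show ?thesis
    using first_terms_determine[OF assms(1-3), of _ \<gamma>]
    by (intro eventually_sequentiallyI[of "max (card {\<alpha>\<in>supp \<phi>. weight w \<gamma> \<le> weight w \<alpha>})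
        (card {\<alpha>\<in>supp \<psi>. weight w \<gamma> \<le> weight w \<alpha>})"]) auto
qed

text \<open>Each pair of distinct series is separated for all large \<open>N\<close>, and finitely
  many such conditions hold simultaneously for large \<open>N\<close>.\<close>

lemma eventually_distinguished_by_first_terms:
  assumes w: "rat_independent w" and "finite R" "\<And>\<phi>. \<phi> \<in> R \<Longrightarrow> weight_finite w \<phi>"
  shows "eventually (\<lambda>N. distinguished_by_first_terms w N R) sequentially"
proof -
  have "eventually (\<lambda>N. \<forall>\<phi>\<in>R. \<forall>\<psi>\<in>R. \<phi> \<noteq> \<psi> \<longrightarrow> first_terms w N \<phi> \<noteq> first_terms w N \<psi>) sequentially"
    using assms by (intro eventually_ball_finite ballI) (auto simp: eventually_first_terms_differ)
  then show ?thesis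
    by eventually_elim (auto simp: distinguished_by_first_terms_def inj_on_def)
qed

lemma first_terms_eq_leading_exponent:
  assumes "first_terms w N \<psi> = first_terms w N \<phi>" "N \<ge> 1" "supp \<phi> \<noteq> {}"
  shows "supp \<psi> \<noteq> {}" "leading_exponent w \<psi> = leading_exponent w \<phi>"
  using assms by (cases N; auto simp: Let_def split: if_splits)+

theorem proposition2:
  fixes p :: "('a::{alg_closed_field, field_char_0}, 'n::finite) xpoly poly"
    and e :: "((real ^ 'n) \<times> real) set"
    and w :: "real ^ 'n"
    and N :: nat
    and \<phi> :: "('a, 'n) fsum"
    and ts :: "((rat ^ 'n) \<times> 'a) list"
  assumes "squarefree p"
    and "\<not> (\<exists>c. p = [:Poly_Mapping.single 0 c:])"
    and "admissible_edge e (Newt p)"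
    and "w \<in> dual_barrier_cone p e"
    and "rat_independent w"
    and "N = (LEAST N. N \<ge> 1 \<and> distinguished_by_first_terms w N (series_roots p e w))"
    and "\<phi> \<in> series_roots p e w"
    and "ts = first_terms w N \<phi>"
  shows "{\<psi>. series_solution w p \<psi> \<and> first_terms w N \<psi> = ts} = {\<phi>}"
proof -
  \<comment> \<open>The zero polynomial counts as constant, so it is excluded by the assumption that
    \<open>p\<close> is non-constant.\<close>
  have "p = [:Poly_Mapping.single 0 0:]" if "p = 0" using that by simp
  with assms(2) have "p \<noteq> 0" by blast
  let ?R = "series_roots p e w"
  have wf: "weight_finite w \<psi>" "series_eval p \<psi> = (\<lambda>_. 0)" if "\<psi> \<in> ?R" for \<psi>
    using that weight_finite_series_field[OF assms(5)]
    by (auto simp: series_roots_def series_solution_def)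
  have "finite ?R"
    by (rule finite_subset[OF _ finite_weight_finite_roots[OF assms(5) \<open>p \<noteq> 0\<close>]]) (use wf in blast)
  then have "eventually (\<lambda>N. N \<ge> 1 \<and> distinguished_by_first_terms w N ?R) sequentially"
    using wf(1) assms(5)
    by (intro eventually_conj eventually_ge_at_top eventually_distinguished_by_first_terms)
  then have "\<exists>N. N \<ge> 1 \<and> distinguished_by_first_terms w N ?R"
    using eventually_happens trivial_limit_sequentially by blast
  then have N: "N \<ge> 1" "inj_on (first_terms w N) ?R"
    unfolding assms(6) distinguished_by_first_terms_def
    by (metis (mono_tags, lifting) LeastI_ex)+
  have "\<psi> = \<phi>" if "series_solution w p \<psi>" "first_terms w N \<psi> = ts" for \<psi>
  proof -
    \<comment> \<open>As \<open>N \<ge> 1\<close>, the head of the common list fixes the leading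
      exponent of \<psi>, which is therefore \<open>- slope e\<close>.\<close>
    have "\<psi> \<in> ?R"
      using that assms(7,8) first_terms_eq_leading_exponent[of w N \<psi> \<phi>] N(1)
      by (auto simp: series_roots_def)
    then show ?thesis
      using N(2) assms(7,8) that(2) by (auto dest: inj_onD)
  qed
  with assms(7,8) show ?thesis by (auto simp: series_roots_def)
qed

end
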